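(* Let $t_0>0$, $\delta>0$ and $\frac23<r<2$. Let $x:[t_0,+\infty[\to\mathcal H$ be a global solution trajectory of $$\ddot x(t)+\frac{\delta}{t^{r/2}}\dot x(t)+\nabla f(x(t))+\frac{1}{t^r}x(t)=0 .$$ Then $\liminf_{t\to+\infty}\|x(t)-x^*\|=0$. Further, if there exists $T\ge t_0$ such that the trajectory $\{x(t):t\ge T\}$ stays either in the open ball $B(0,\|x^*\|)$ or in its complement, then $x(t)$ converges strongly to $x^*$ as $t\to+\infty$.
   Context: $\mathcal H$ is a real Hilbert space with scalar product $\langle\cdot,\cdot\rangle$ and norm $\|\cdot\|$. The function $f:\mathcal H\to\mathbb R$ is convex and differentiable, $\nabla f$ is Lipschitz continuous on bounded sets, and $S=\operatorname{argmin} f$ is nonempty; $x^*$ denotes the element of minimum norm of $S$. $B(0,\rho)=\{x\in\mathcal H:\|x\|<\rho\}$. Solutions are classical (twice differentiable) solutions on $[t_0,+\infty[$. *)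

theory Defs
  imports "HOL-Analysis.Analysis"
begin

definition lipschitz_on_bounded_sets :: "('a::metric_space \<Rightarrow> 'b::metric_space) \<Rightarrow> bool" where
  "lipschitz_on_bounded_sets g \<longleftrightarrow> (\<forall>B. bounded B \<longrightarrow> (\<exists>L. L-lipschitz_on B g))"

definition argmin_set :: "('a \<Rightarrow> real) \<Rightarrow> 'a set" where
  "argmin_set f = {z. is_arg_min f (\<lambda>_. True) z}"

definition is_min_norm_element :: "'a::real_normed_vector set \<Rightarrow> 'a \<Rightarrow> bool" where
  "is_min_norm_element S z \<longleftrightarrow> is_arg_min norm (\<lambda>y. y \<in> S) z"

text \<open>Classical solutions of x'' + (\<delta> / t^(r/2)) x' + g(x) + (1 / t^r) x = 0 on the half-line
  from \<open>t0\<close>. Derivatives are taken within the half-line, hence are one-sided at \<open>t0\<close>, and the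
  values of \<open>x\<close> to the left of \<open>t0\<close> are irrelevant.\<close>

definition is_global_trajectory ::
  "('a::real_normed_vector \<Rightarrow> 'a) \<Rightarrow> real \<Rightarrow> real \<Rightarrow> real \<Rightarrow> (real \<Rightarrow> 'a) \<Rightarrow> bool" where
  "is_global_trajectory g \<delta> r t0 x \<longleftrightarrow>
    (\<exists>x' x''. \<forall>t\<ge>t0.
       (x has_vector_derivative x' t) (at t within {t0..}) \<and>
       (x' has_vector_derivative x'' t) (at t within {t0..}) \<and>
       x'' t + (\<delta> / t powr (r / 2)) *\<^sub>R x' t + g (x t) + (1 / t powr r) *\<^sub>R x t = 0)"

end

theory Submission
  imports Defs "HOL-Real_Asymp.Real_Asymp"
begin

text \<open>
  The trajectory converges strongly to the minimum norm minimizer \<open>p = x\<^sup>*\<close>; both claims follow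
  from this. Two independent facts are combined.

  Well-posedness of Tikhonov regularization: if \<open>f (u i) \<longlongrightarrow> f p\<close> and
  \<open>limsup \<parallel>u i\<parallel> \<le> \<parallel>p\<parallel>\<close>, then \<open>u i \<longlongrightarrow> p\<close> strongly
  (\<open>minimizing_net_tendsto_min_norm\<close>). Near-minimizers of \<open>f\<close> cannot have norm much below
  \<open>\<parallel>p\<parallel>\<close>, and this applies to the midpoint of \<open>u i\<close> and \<open>p\<close> as well, so the parallelogram
  identity forces the two points together.

  Decay of an energy: put \<open>\<epsilon> = t powr - r\<close>, \<open>s = sqrt \<epsilon>\<close> and
  \<open>\<phi> = (f (x t) + \<epsilon> / 2 * \<parallel>x t\<parallel>\<^sup>2) - (f p + \<epsilon> / 2 * \<parallel>p\<parallel>\<^sup>2)\<close>, the gap of the regularized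
  objective. Since that objective is \<open>\<epsilon>\<close>-strongly convex and the damping is proportional to
  \<open>s\<close>, as in the heavy ball method, the energy
  \<open>E = \<phi> + 1/2 * \<parallel>a s (x t - p) + x' t\<parallel>\<^sup>2\<close> decreases at the rate \<open>a s E\<close> for a small constant
  \<open>a > 0\<close>, up to an error caused by the drift of \<open>\<epsilon>\<close>
  (\<open>energy_differential_inequality\<close>). This error is of order \<open>\<epsilon>' = O(t powr (- r - 1))\<close>, which is
  negligible against \<open>s \<epsilon> = t powr (- 3 r / 2)\<close> exactly because \<open>r < 2\<close>. Hence \<open>E = o(\<epsilon>)\<close>
  (\<open>energy_little_o\<close>).

  As \<open>\<phi> \<le> E\<close>, the bound \<open>f (x t) - f p + \<epsilon> / 2 * (\<parallel>x t\<parallel>\<^sup>2 - \<parallel>p\<parallel>\<^sup>2) \<le> o(\<epsilon>)\<close> follows. It gives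
  \<open>f (x t) \<longlongrightarrow> f p\<close> and, after dropping \<open>f (x t) - f p \<ge> 0\<close> and dividing by \<open>\<epsilon>\<close>,
  \<open>limsup \<parallel>x t\<parallel> \<le> \<parallel>p\<parallel>\<close>. Centering the energy at the fixed point \<open>p\<close>, instead of at the
  moving minimizer of the regularized objective, costs nothing: \<open>\<phi>\<close> may become negative, but no
  sign of \<open>E\<close> enters the argument.
\<close>

section \<open>Well-posedness of minimum norm selection\<close>

lemma norm_diff_sq_parallelogram:
  fixes u v :: "'a::real_inner"
  shows "(norm (u - v))\<^sup>2 = 2 * (norm u)\<^sup>2 + 2 * (norm v)\<^sup>2 - 4 * (norm (midpoint u v))\<^sup>2"
  by (simp add: midpoint_def power2_norm_eq_inner inner_commute algebra_simps)

lemma convex_on_midpoint_le: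
  assumes "convex_on UNIV f" and "f u \<le> c" and "f v \<le> c"
  shows "f (midpoint u v) \<le> c"
proof -
  have "f (midpoint u v) \<le> (1 - 1/2) * f u + 1/2 * f v"
    using convex_onD[OF assms(1), of "1/2" u v] by (simp add: midpoint_def algebra_simps)
  with assms(2,3) show ?thesis by simp
qed

text \<open>
  Let \<open>m n\<close> be the infimum of the squared norm over the sublevel set of height \<open>f p + 1 / (n + 1)\<close>,
  and let \<open>M\<close> be the limit of this increasing sequence. Almost minimal points of the sublevel sets
  form a Cauchy sequence, by convexity and the parallelogram identity. Its limit minimizes \<open>f\<close> and
  has squared norm at most \<open>M\<close>, so \<open>\<parallel>p\<parallel>\<^sup>2 \<le> M\<close>.
\<close>

lemma sublevel_norms_near_min_norm:
  fixes f :: "'a::{real_inner, complete_space} \<Rightarrow> real"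
  assumes convex: "convex_on UNIV f" and cont: "continuous_on UNIV f"
    and p: "is_min_norm_element (argmin_set f) p" and e: "e > 0"
  shows "\<exists>\<eta>>0. \<forall>z. f z \<le> f p + \<eta> \<longrightarrow> (norm p)\<^sup>2 - e < (norm z)\<^sup>2"
proof -
  define L where "L n = {z. f z \<le> f p + 1 / real (Suc n)}" for n
  define m where "m n = Inf ((\<lambda>z. (norm z)\<^sup>2) ` L n)" for n
  have bdd: "bdd_below ((\<lambda>z. (norm z)\<^sup>2) ` L n)" for n
    by (rule bdd_belowI2[where m = 0]) simp
  have pL: "p \<in> L n" for n
    by (simp add: L_def)
  have m_le: "m n \<le> (norm z)\<^sup>2" if "z \<in> L n" for n z
    unfolding m_def by (rule cINF_lower[OF bdd that])
  have L_antimono: "L k \<subseteq> L n" if "n \<le> k" for n k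
  proof -
    have "1 / real (Suc k) \<le> 1 / real (Suc n)"
      using that by (simp add: frac_le)
    then show ?thesis by (auto simp: L_def)
  qed
  have "incseq m"
  proof (rule monoI)
    fix n k :: nat
    assume "n \<le> k"
    then show "m n \<le> m k"
      unfolding m_def using pL[of k] L_antimono[of n k] bdd by (intro cINF_superset_mono) auto
  qed
  then obtain M where M: "m \<longlonglongrightarrow> M"
    using incseq_convergent m_le[OF pL] by blast
  have "\<exists>z\<in>L n. (norm z)\<^sup>2 < m n + 1 / real (Suc n)" for n
    using cINF_less_iff[OF _ bdd, of n "m n + 1 / real (Suc n)"] pL[of n]
    unfolding m_def by auto
  then obtain z where zL: "\<And>n. z n \<in> L n" and z_lt: "\<And>n. (norm (z n))\<^sup>2 < m n + 1 / real (Suc n)"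
    by metis
  have M_le: "m n \<le> M" for n
    using \<open>incseq m\<close> M by (rule incseq_le)
  have dist_sq: "(dist (z n) (z k))\<^sup>2 \<le> 4 * (M - m n) + 4 / real (Suc n)" if "n \<le> k" for n k
  proof -
    have "f (midpoint (z n) (z k)) \<le> f p + 1 / real (Suc n)"
      using convex_on_midpoint_le[OF convex] zL[of n] zL[of k] L_antimono[OF that]
      by (auto simp: L_def)
    then have "m n \<le> (norm (midpoint (z n) (z k)))\<^sup>2"
      by (intro m_le) (simp add: L_def)
    moreover have "1 / real (Suc k) \<le> 1 / real (Suc n)"
      using that by (simp add: frac_le)
    ultimately show ?thesis
      using norm_diff_sq_parallelogram[of "z n" "z k"] z_lt[of n] z_lt[of k] M_le[of k] M_le[of n]
      by (simp add: dist_norm)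
  qed
  have bound0: "(\<lambda>n. 4 * (M - m n) + 4 / real (Suc n)) \<longlonglongrightarrow> 0"
  proof -
    have "(\<lambda>n. 4 * (M - m n) + 4 * inverse (real (Suc n))) \<longlonglongrightarrow> 4 * (M - M) + 4 * 0"
      by (intro tendsto_intros M LIMSEQ_inverse_real_of_nat)
    then show ?thesis by (simp add: divide_inverse)
  qed
  have "Cauchy z"
  proof (rule CauchyI')
    fix d :: real
    assume "d > 0"
    then have "eventually (\<lambda>n. 4 * (M - m n) + 4 / real (Suc n) < d\<^sup>2) sequentially"
      by (intro order_tendstoD(2)[OF bound0]) simp
    then obtain N where N: "\<And>n. n \<ge> N \<Longrightarrow> 4 * (M - m n) + 4 / real (Suc n) < d\<^sup>2"
      by (auto simp: eventually_sequentially)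
    have "dist (z n) (z k) < d" if "n \<ge> N" "n < k" for n k
      using dist_sq[of n k] N[of n] that \<open>d > 0\<close>
      by (intro power2_less_imp_less[of "dist (z n) (z k)" d]) auto
    then show "\<exists>M. \<forall>m\<ge>M. \<forall>n>m. dist (z m) (z n) < d"
      by (intro exI[of _ N]) simp
  qed
  then obtain q where q: "z \<longlonglongrightarrow> q"
    using Cauchy_convergent convergent_def by blast
  have inv0: "(\<lambda>n. 1 / real (Suc n)) \<longlonglongrightarrow> 0"
    using LIMSEQ_inverse_real_of_nat by (simp add: divide_inverse)
  have "(\<lambda>n. f (z n)) \<longlonglongrightarrow> f q"
    using continuous_on_tendsto_compose[OF cont q] by simp
  moreover have "(\<lambda>n. f p + 1 / real (Suc n)) \<longlonglongrightarrow> f p + 0"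
    by (intro tendsto_intros inv0)
  ultimately have "f q \<le> f p + 0"
    using zL by (intro LIMSEQ_le) (auto simp: L_def)
  then have "f q \<le> f p"
    by simp
  also have "f p \<le> f y" for y
    using p by (simp add: is_min_norm_element_def argmin_set_def is_arg_min_linorder)
  finally have "f q \<le> f y" for y .
  then have "q \<in> argmin_set f"
    by (simp add: argmin_set_def is_arg_min_linorder)
  then have "norm p \<le> norm q"
    using p by (simp add: is_min_norm_element_def is_arg_min_linorder)
  then have "(norm p)\<^sup>2 \<le> (norm q)\<^sup>2"
    by (simp add: power_mono)
  also have "(norm q)\<^sup>2 \<le> M + 0"
  proof (rule LIMSEQ_le)
    show "(\<lambda>n. (norm (z n))\<^sup>2) \<longlonglongrightarrow> (norm q)\<^sup>2"
      by (intro tendsto_intros q)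
    show "(\<lambda>n. m n + 1 / real (Suc n)) \<longlonglongrightarrow> M + 0"
      by (intro tendsto_intros M inv0)
    show "\<exists>N. \<forall>n\<ge>N. (norm (z n))\<^sup>2 \<le> m n + 1 / real (Suc n)"
      using z_lt less_imp_le by blast
  qed
  finally have "(norm p)\<^sup>2 - e < M"
    using e by simp
  then have "eventually (\<lambda>n. (norm p)\<^sup>2 - e < m n) sequentially"
    by (rule order_tendstoD(1)[OF M])
  then obtain n where "(norm p)\<^sup>2 - e < m n"
    using eventually_happens by force
  then have "(norm p)\<^sup>2 - e < (norm z)\<^sup>2" if "f z \<le> f p + 1 / real (Suc n)" for z
    using m_le[of z n] that by (simp add: L_def)
  then show ?thesis
    by (intro exI[of _ "1 / real (Suc n)"]) simp
qed

text \<open>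
  The midpoint of \<open>u i\<close> and \<open>p\<close> is again a near-minimizer, so its norm is almost at least
  \<open>\<parallel>p\<parallel>\<close>, while both endpoints have norm almost at most \<open>\<parallel>p\<parallel>\<close>.
\<close>

lemma minimizing_net_tendsto_min_norm:
  fixes f :: "'a::{real_inner, complete_space} \<Rightarrow> real"
  assumes convex: "convex_on UNIV f" and cont: "continuous_on UNIV f"
    and p: "is_min_norm_element (argmin_set f) p"
    and vals: "((\<lambda>i. f (u i)) \<longlongrightarrow> f p) F"
    and norms: "\<And>e. e > 0 \<Longrightarrow> eventually (\<lambda>i. (norm (u i))\<^sup>2 \<le> (norm p)\<^sup>2 + e) F"
  shows "(u \<longlongrightarrow> p) F"
proof (rule tendstoI)
  fix d :: real
  assume d: "d > 0"
  \<comment> \<open>The parallelogram identity turns errors \<open>e\<close> in the squared norms into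
    \<open>(dist (u i) p)\<^sup>2 \<le> 2 * e + 4 * e\<close>; any divisor above 6 works.\<close>
  define e where "e = d\<^sup>2 / 7"
  have e: "e > 0"
    using d by (simp add: e_def)
  obtain \<eta> where \<eta>: "\<eta> > 0" and low: "\<And>z. f z \<le> f p + \<eta> \<Longrightarrow> (norm p)\<^sup>2 - e < (norm z)\<^sup>2"
    using sublevel_norms_near_min_norm[OF convex cont p e] by auto
  have "eventually (\<lambda>i. f (u i) < f p + \<eta>) F"
    using \<eta> by (intro order_tendstoD(2)[OF vals]) simp
  with norms[OF e] show "eventually (\<lambda>i. dist (u i) p < d) F"
  proof eventually_elim
    case (elim i)
    have "(norm p)\<^sup>2 - e < (norm (midpoint (u i) p))\<^sup>2"
      using elim(2) \<eta> by (intro low convex_on_midpoint_le[OF convex]) auto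
    then have "(dist (u i) p)\<^sup>2 \<le> 6 / 7 * d\<^sup>2"
      using norm_diff_sq_parallelogram[of "u i" p] elim(1) by (simp add: dist_norm e_def)
    also have "\<dots> < d\<^sup>2"
      using d by simp
    finally show ?case
      using d by (intro power2_less_imp_less[of "dist (u i) p" d]) auto
  qed
qed

section \<open>Convexity and derivatives along curves\<close>

text \<open>Restriction to the segment from \<open>z\<close> to \<open>w\<close> reduces this to the tangent line inequality.\<close>

lemma convex_on_above_tangent_plane:
  fixes f :: "'a::real_inner \<Rightarrow> real"
  assumes convex: "convex_on UNIV f" and grad: "GDERIV f z :> g"
  shows "f w \<ge> f z + inner (w - z) g"
proof -
  define h where "h = (\<lambda>u. f (z + u *\<^sub>R (w - z)))"
  have "convex_on UNIV h"
  proof (rule convex_onI)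
    fix t u v :: real
    assume t: "0 < t" "t < 1"
    have "z + ((1 - t) *\<^sub>R u + t *\<^sub>R v) *\<^sub>R (w - z)
        = (1 - t) *\<^sub>R (z + u *\<^sub>R (w - z)) + t *\<^sub>R (z + v *\<^sub>R (w - z))"
      by (simp add: algebra_simps)
    then show "h ((1 - t) *\<^sub>R u + t *\<^sub>R v) \<le> (1 - t) * h u + t * h v"
      unfolding h_def using convex_onD[OF convex, of t] t by auto
  qed simp
  moreover have "(h has_real_derivative inner (w - z) g) (at 0)"
  proof -
    have "((\<lambda>u::real. z + u *\<^sub>R (w - z)) has_derivative (\<lambda>u. u *\<^sub>R (w - z))) (at 0)"
      by (auto intro!: derivative_eq_intros)
    moreover have "(f has_derivative (\<lambda>k. inner k g)) (at (z + 0 *\<^sub>R (w - z)))"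
      using grad by (simp add: gderiv_def)
    ultimately have "((\<lambda>u. f (z + u *\<^sub>R (w - z))) has_derivative
        (\<lambda>u. inner (u *\<^sub>R (w - z)) g)) (at 0)"
      by (rule has_derivative_compose)
    then show ?thesis
      unfolding h_def has_field_derivative_def by (simp add: mult_commute_abs)
  qed
  ultimately have "h 1 - h 0 \<ge> inner (w - z) g * (1 - 0)"
    by (intro convex_on_imp_above_tangent[where A = UNIV]) auto
  then show ?thesis
    by (simp add: h_def)
qed

lemma has_real_derivative_norm_sq:
  fixes u :: "real \<Rightarrow> 'a::real_inner"
  assumes "(u has_vector_derivative u') (at t)"
  shows "((\<lambda>t. (norm (u t))\<^sup>2) has_real_derivative 2 * inner (u t) u') (at t)"
proof -
  have "(u has_derivative (\<lambda>k. k *\<^sub>R u')) (at t)"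
    using assms by (simp add: has_vector_derivative_def)
  from has_derivative_inner[OF this this] show ?thesis
    unfolding power2_norm_eq_inner has_field_derivative_def
    by (rule has_derivative_eq_rhs) (simp add: fun_eq_iff inner_commute)
qed

section \<open>Dissipation of the energy\<close>

text \<open>
  The curve \<open>v\<close> stands for the velocity of \<open>x\<close>. The point \<open>p\<close> is the center of the energy, and
  \<open>a * t powr (- r / 2)\<close> is the weight that couples position to velocity.
\<close>

definition energy ::
  "('a::real_inner \<Rightarrow> real) \<Rightarrow> real \<Rightarrow> real \<Rightarrow> 'a \<Rightarrow> (real \<Rightarrow> 'a) \<Rightarrow> (real \<Rightarrow> 'a) \<Rightarrow> real \<Rightarrow> real" where
  "energy f a r p x v t = f (x t) - f p + t powr - r / 2 * ((norm (x t))\<^sup>2 - (norm p)\<^sup>2)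
    + 1 / 2 * (norm ((a * t powr (- r / 2)) *\<^sub>R (x t - p) + v t))\<^sup>2"

text \<open>
  The quadratic form that governs the dissipation, with \<open>Y\<close> for \<open>s \<parallel>y\<parallel>\<close> and \<open>W\<close> for \<open>\<parallel>v\<parallel>\<close>. For
  small \<open>a\<close> the diagonal coefficients are of order \<open>a\<close> and \<open>1\<close>, so their product, of order \<open>a\<close>,
  dominates the square of the cross coefficient, of order \<open>a\<^sup>2\<close>.
\<close>

lemma dissipation_form_nonpos:
  fixes Y W a \<delta> :: real
  assumes "0 < a" "a \<le> \<delta> / 4" "a * \<delta> \<le> 1 / 4" "a \<le> 1 / 4"
  shows "a * \<delta> * (Y * W) \<le> a * (1 - a\<^sup>2) / 2 * Y\<^sup>2 + (\<delta> - 3 / 2 * a) * W\<^sup>2"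
proof -
  have \<delta>: "\<delta> > 0"
    using assms by simp
  have "a * \<delta> * (Y * W) \<le> a * (Y\<^sup>2 / 4 + (\<delta> * W)\<^sup>2)"
    using mult_left_mono[of "\<delta> * (Y * W)" "Y\<^sup>2 / 4 + (\<delta> * W)\<^sup>2" a] assms(1)
      zero_le_power2[of "Y / 2 - \<delta> * W"]
    by (simp add: power2_eq_square algebra_simps)
  also have "\<dots> = a / 4 * Y\<^sup>2 + a * \<delta> * \<delta> * W\<^sup>2"
    by (simp add: power2_eq_square algebra_simps)
  also have "\<dots> \<le> a * (1 - a\<^sup>2) / 2 * Y\<^sup>2 + (\<delta> - 3 / 2 * a) * W\<^sup>2"
  proof (intro add_mono mult_right_mono)
    have "a\<^sup>2 \<le> 1 / 2"
      using power_mono[of a "1 / 4" 2] assms by (simp add: power2_eq_square)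
    then show "a / 4 \<le> a * (1 - a\<^sup>2) / 2"
      using mult_left_mono[of "1 / 2" "1 - a\<^sup>2" a] assms(1) by simp
    show "a * \<delta> * \<delta> \<le> \<delta> - 3 / 2 * a"
    proof -
      have "a * \<delta> * \<delta> \<le> 1 / 4 * \<delta>"
        using assms(3) \<delta> by (intro mult_right_mono) auto
      then show ?thesis
        using assms(2) \<delta> by linarith
    qed
  qed auto
  finally show ?thesis .
qed

text \<open>
  The algebraic core, at a fixed time: \<open>y\<close> is \<open>x - p\<close>, \<open>v\<close> the velocity, \<open>g\<close> the gradient of the
  regularized objective at \<open>x\<close>, \<open>\<phi>\<close> the gap of that objective and \<open>- \<eta> s\<^sup>2\<close> the derivative of \<open>s\<close>.
  The first two summands are the derivative of the energy without the drift of \<open>\<epsilon> = s\<^sup>2\<close> in \<open>\<phi>\<close>;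
  the second vector in the second summand is the derivative of \<open>a s y + v\<close> along the
  differential equation. The decay rate \<open>a s\<close> is equal to the weight of \<open>y\<close>: then \<open>\<phi>\<close> occurs only
  in the slack \<open>inner y g - \<phi> - s\<^sup>2 / 2 * \<parallel>y\<parallel>\<^sup>2 \<ge> 0\<close> of strong convexity, and the sign of \<open>\<phi>\<close>
  is irrelevant.
\<close>

lemma energy_dissipation:
  fixes y v g :: "'a::real_inner" and a \<delta> s \<eta> \<phi> :: real
  assumes a: "0 < a" "a \<le> \<delta> / 4" "a * \<delta> \<le> 1 / 4" "a \<le> 1 / 4"
    and s: "s > 0" and \<eta>: "0 \<le> \<eta>" "\<eta> \<le> 2 * a"
    and strong: "\<phi> + s\<^sup>2 / 2 * (norm y)\<^sup>2 \<le> inner y g"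
  shows "inner v g
      + inner ((a * s) *\<^sub>R y + v) ((- a * \<eta> * s\<^sup>2) *\<^sub>R y + (a * s) *\<^sub>R v - (\<delta> * s) *\<^sub>R v - g)
      + a * s * (\<phi> + 1 / 2 * (norm ((a * s) *\<^sub>R y + v))\<^sup>2) \<le> 0"
    (is "?D \<le> 0")
proof -
  define Y W where "Y = s * norm y" and "W = norm v"
  \<comment> \<open>The terms with a favourable sign: the slack of strong convexity and the decrease of \<open>s\<close>.\<close>
  define R where "R = a * s * (inner y g - \<phi> - s\<^sup>2 / 2 * (norm y)\<^sup>2) + a\<^sup>2 * \<eta> * s * Y\<^sup>2"
  have "R \<ge> 0"
    unfolding R_def using a s \<eta> strong by simp
  have "s * ((2 * a - \<delta> - \<eta>) * inner y v) \<le> s * (\<delta> * (norm y * norm v))"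
  proof (rule mult_left_mono)
    have "(2 * a - \<delta> - \<eta>) * inner y v \<le> \<bar>2 * a - \<delta> - \<eta>\<bar> * \<bar>inner y v\<bar>"
      by (metis abs_ge_self abs_mult)
    also have "\<dots> \<le> \<delta> * (norm y * norm v)"
      using a \<eta> by (intro mult_mono Cauchy_Schwarz_ineq2) auto
    finally show "(2 * a - \<delta> - \<eta>) * inner y v \<le> \<delta> * (norm y * norm v)" .
  qed (use s in simp)
  then have "a * s * (s * ((2 * a - \<delta> - \<eta>) * inner y v)) \<le> a * s * (s * (\<delta> * (norm y * norm v)))"
    using a s by (intro mult_left_mono) auto
  also have "\<dots> = s * (a * \<delta> * (Y * W))"
    by (simp add: Y_def W_def)
  finally have cross: "a * s * (s * ((2 * a - \<delta> - \<eta>) * inner y v)) \<le> s * (a * \<delta> * (Y * W))" .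
  have "?D = - R + a * s * (s * ((2 * a - \<delta> - \<eta>) * inner y v))
      - s * (a * (1 - a\<^sup>2) / 2 * Y\<^sup>2 + (\<delta> - 3 / 2 * a) * W\<^sup>2)"
    unfolding R_def Y_def W_def power_mult_distrib power2_norm_eq_inner
    by (simp add: inner_simps inner_commute field_simps power2_eq_square)
  also have "\<dots> \<le> s * (a * \<delta> * (Y * W) - (a * (1 - a\<^sup>2) / 2 * Y\<^sup>2 + (\<delta> - 3 / 2 * a) * W\<^sup>2))"
    using cross \<open>R \<ge> 0\<close> by (simp add: algebra_simps)
  also have "\<dots> \<le> 0"
    using dissipation_form_nonpos[OF a, of Y W] s by (intro mult_nonneg_nonpos) auto
  finally show ?thesis .
qed

text \<open>
  Relative to \<open>energy_dissipation\<close> the only new term is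
  \<open>\<epsilon>' / 2 * (\<parallel>x t\<parallel>\<^sup>2 - \<parallel>p\<parallel>\<^sup>2)\<close>. As \<open>\<epsilon>\<close> decreases, its part
  with \<open>x t\<close> is nonpositive and can be dropped, which leaves an error bound that does not depend on
  the trajectory. The hypothesis \<open>slow\<close> bounds \<open>\<eta> = - s' / s\<^sup>2\<close>.
\<close>

lemma energy_differential_inequality:
  fixes f :: "'a::real_inner \<Rightarrow> real" and x v :: "real \<Rightarrow> 'a"
  assumes convex: "convex_on UNIV f" and grad: "GDERIV f (x t) :> g"
    and a: "0 < a" "a \<le> \<delta> / 4" "a * \<delta> \<le> 1 / 4" "a \<le> 1 / 4"
    and t: "t > 0" and r: "r > 0" and slow: "r / 2 * t powr (r / 2 - 1) \<le> 2 * a"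
    and x: "(x has_vector_derivative v t) (at t)" and v: "(v has_vector_derivative w) (at t)"
    and ode: "w + (\<delta> * t powr (- r / 2)) *\<^sub>R v t + g + (t powr - r) *\<^sub>R x t = 0"
  shows "\<exists>D. (energy f a r p x v has_real_derivative D) (at t) \<and>
    D + a * t powr (- r / 2) * energy f a r p x v t \<le> r / 2 * (norm p)\<^sup>2 * t powr (- r - 1)"
proof -
  define s \<eta> where "s = t powr (- r / 2)" and "\<eta> = r / 2 * t powr (r / 2 - 1)"
  define y where "y = x t - p"
  define h where "h = g + (t powr - r) *\<^sub>R x t"
  define \<phi> where "\<phi> = f (x t) - f p + t powr - r / 2 * ((norm (x t))\<^sup>2 - (norm p)\<^sup>2)"
  have s2: "t powr - r = s\<^sup>2"
    unfolding s_def power2_eq_square by (simp flip: powr_add)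
  have s': "- r / 2 * t powr (- r / 2 - 1) = - \<eta> * s\<^sup>2"
    unfolding s2[symmetric] \<eta>_def by (simp flip: powr_add)
  have w: "w = - (\<delta> * s) *\<^sub>R v t - h"
    using ode unfolding s_def h_def by (simp add: eq_neg_iff_add_eq_0 algebra_simps)
  have strong: "\<phi> + s\<^sup>2 / 2 * (norm y)\<^sup>2 \<le> inner y h"
  proof -
    have "s\<^sup>2 / 2 * ((norm (x t))\<^sup>2 - (norm p)\<^sup>2) + s\<^sup>2 / 2 * (norm y)\<^sup>2 = s\<^sup>2 * inner y (x t)"
      by (simp add: y_def power2_norm_eq_inner inner_simps inner_commute field_simps)
    then show ?thesis
      using convex_on_above_tangent_plane[OF convex grad, of p]
      unfolding \<phi>_def h_def s2 by (simp add: y_def inner_simps)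
  qed
  define D where "D = - r / 2 * t powr (- r - 1) * ((norm (x t))\<^sup>2 - (norm p)\<^sup>2) + (inner (v t) h
      + inner ((a * s) *\<^sub>R y + v t) ((- a * \<eta> * s\<^sup>2) *\<^sub>R y + (a * s) *\<^sub>R v t - (\<delta> * s) *\<^sub>R v t - h))"
  have "D + a * s * energy f a r p x v t \<le> - r / 2 * t powr (- r - 1) * ((norm (x t))\<^sup>2 - (norm p)\<^sup>2)"
    using energy_dissipation[OF a _ _ _ strong, of \<eta> "v t"] t r slow
    unfolding D_def energy_def \<phi>_def[symmetric] s_def[symmetric] y_def[symmetric]
    by (simp add: s_def \<eta>_def)
  also have "\<dots> \<le> r / 2 * (norm p)\<^sup>2 * t powr (- r - 1)"
    using r by (simp add: algebra_simps)
  finally have bound: "D + a * s * energy f a r p x v t \<le> \<dots>" .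
  define u where "u = (\<lambda>\<tau>. (a * \<tau> powr (- r / 2)) *\<^sub>R (x \<tau> - p) + v \<tau>)"
  define u' where "u' = (a * s) *\<^sub>R v t + (- a * \<eta> * s\<^sup>2) *\<^sub>R y + w"
  have fx: "((\<lambda>\<tau>. f (x \<tau>)) has_real_derivative inner (v t) g) (at t)"
  proof -
    have "(x has_derivative (\<lambda>k. k *\<^sub>R v t)) (at t)"
      using x by (simp add: has_vector_derivative_def)
    from has_derivative_compose[OF this grad[unfolded gderiv_def]] show ?thesis
      by (simp add: has_field_derivative_def mult_commute_abs)
  qed
  have eps: "((\<lambda>\<tau>. \<tau> powr - r / 2) has_real_derivative - r / 2 * t powr (- r - 1)) (at t)"
    using t by (auto intro!: derivative_eq_intros simp: powr_diff)
  have "((\<lambda>\<tau>. a * \<tau> powr (- r / 2)) has_real_derivative a * (- r / 2 * t powr (- r / 2 - 1))) (at t)"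
    using t by (auto intro!: derivative_eq_intros)
  then have weight: "((\<lambda>\<tau>. a * \<tau> powr (- r / 2)) has_real_derivative - a * \<eta> * s\<^sup>2) (at t)"
    unfolding s' by (simp add: mult.assoc)
  have "((\<lambda>\<tau>. x \<tau> - p) has_vector_derivative v t) (at t)"
    using has_vector_derivative_diff[OF x has_vector_derivative_const] by simp
  from has_vector_derivative_add[OF has_vector_derivative_scaleR[OF weight this] v]
  have "(u has_vector_derivative u') (at t)"
    unfolding u_def by (simp only: u'_def s_def y_def)
  note norms = has_real_derivative_norm_sq[OF x] has_real_derivative_norm_sq[OF this]
  have ut: "u t = (a * s) *\<^sub>R y + v t"
    by (simp add: u_def s_def y_def)
  have "((\<lambda>\<tau>. f (x \<tau>) - f p + \<tau> powr - r / 2 * ((norm (x \<tau>))\<^sup>2 - (norm p)\<^sup>2)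
        + 1 / 2 * (norm (u \<tau>))\<^sup>2) has_real_derivative
      (inner (v t) g - 0) + (- r / 2 * t powr (- r - 1) * ((norm (x t))\<^sup>2 - (norm p)\<^sup>2)
        + (2 * inner (x t) (v t) - 0) * (t powr - r / 2)) + 1 / 2 * (2 * inner (u t) u')) (at t)"
    (is "(_ has_real_derivative ?E') _")
    by (intro DERIV_add DERIV_diff DERIV_mult DERIV_cmult fx eps norms DERIV_const)
  moreover have "?E' = D"
  proof -
    have "u' = (- a * \<eta> * s\<^sup>2) *\<^sub>R y + (a * s) *\<^sub>R v t - (\<delta> * s) *\<^sub>R v t - h"
      by (simp add: u'_def w)
    moreover have "inner (v t) h = inner (v t) g + s\<^sup>2 * inner (x t) (v t)"
      by (simp add: h_def s2 inner_simps inner_commute)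
    ultimately show ?thesis
      by (simp add: D_def ut s2)
  qed
  moreover have "energy f a r p x v = (\<lambda>\<tau>. f (x \<tau>) - f p
      + \<tau> powr - r / 2 * ((norm (x \<tau>))\<^sup>2 - (norm p)\<^sup>2) + 1 / 2 * (norm (u \<tau>))\<^sup>2)"
    by (simp add: fun_eq_iff energy_def u_def)
  ultimately have "(energy f a r p x v has_real_derivative D) (at t)"
    by simp
  with bound show ?thesis
    unfolding s_def by blast
qed

section \<open>Decay of solutions of the differential inequality\<close>

text \<open>
  After subtraction of \<open>\<theta> / 2 * t powr - r\<close> the right-hand side disappears for large \<open>t\<close>: the term
  \<open>a * t powr (- r / 2) * (\<theta> / 2 * t powr - r)\<close> beats every multiple of \<open>t powr (- r - 1)\<close> as
  \<open>r < 2\<close>. The homogeneous inequality that remains gives decay like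
  \<open>exp (- (a / b) * t powr b)\<close> with \<open>b = 1 - r / 2 > 0\<close>, faster than any power.
\<close>

lemma energy_little_o:
  fixes E :: "real \<Rightarrow> real" and a r C \<theta> :: real
  assumes a: "a > 0" and r: "0 < r" "r < 2" and \<theta>: "\<theta> > 0"
    and E: "eventually (\<lambda>t. \<exists>D. (E has_real_derivative D) (at t) \<and>
      D + a * t powr (- r / 2) * E t \<le> C * t powr (- r - 1)) at_top"
  shows "eventually (\<lambda>t. E t \<le> \<theta> * t powr - r) at_top"
proof -
  define b where "b = 1 - r / 2"
  have b: "b > 0"
    using r by (simp add: b_def)
  define F where "F t = E t - \<theta> / 2 * t powr - r" for t
  have "((\<lambda>t::real. t powr - b) \<longlongrightarrow> 0) at_top"
    using b by (intro tendsto_neg_powr filterlim_ident) auto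
  then have "((\<lambda>t. (C + \<theta> / 2 * r) * t powr - b) \<longlongrightarrow> 0) at_top"
    by (rule tendsto_mult_right_zero)
  then have "eventually (\<lambda>t. (C + \<theta> / 2 * r) * t powr - b < a * (\<theta> / 2)) at_top"
    using a \<theta> by (intro order_tendstoD(2)) auto
  with E eventually_gt_at_top[of 0]
  have "eventually (\<lambda>t. \<exists>D. (F has_real_derivative D) (at t) \<and>
      D + a * t powr (- r / 2) * F t \<le> 0) at_top"
  proof eventually_elim
    case (elim t)
    then obtain D where D: "(E has_real_derivative D) (at t)"
      "D + a * t powr (- r / 2) * E t \<le> C * t powr (- r - 1)"
      by blast
    have "(C + \<theta> / 2 * r) * t powr - b * t powr (- (3 / 2) * r)
        \<le> a * (\<theta> / 2) * t powr (- (3 / 2) * r)"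
      using elim by (intro mult_right_mono) auto
    moreover have "t powr - b * t powr (- (3 / 2) * r) = t powr (- r - 1)"
      "t powr (- r / 2) * t powr - r = t powr (- (3 / 2) * r)"
      by (simp_all add: b_def flip: powr_add)
    ultimately have "(C + \<theta> / 2 * r) * t powr (- r - 1)
        \<le> a * (\<theta> / 2) * (t powr (- r / 2) * t powr - r)"
      by (simp only: mult.assoc)
    with D(2) have "(D + \<theta> / 2 * r * t powr (- r - 1)) + a * t powr (- r / 2) * F t \<le> 0"
      by (simp add: F_def algebra_simps)
    moreover have "(F has_real_derivative D + \<theta> / 2 * r * t powr (- r - 1)) (at t)"
      unfolding F_def using elim D(1) by (auto intro!: derivative_eq_intros)
    ultimately show ?case
      by blast
  qed
  with eventually_gt_at_top[of 0]
  have "eventually (\<lambda>t. t > 0 \<and> (\<exists>D. (F has_real_derivative D) (at t) \<and>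
      D + a * t powr (- r / 2) * F t \<le> 0)) at_top"
    by (rule eventually_conj)
  then obtain T where T: "\<And>t. t \<ge> T \<Longrightarrow> t > 0 \<and> (\<exists>D. (F has_real_derivative D) (at t) \<and>
      D + a * t powr (- r / 2) * F t \<le> 0)"
    unfolding eventually_at_top_linorder by blast
  \<comment> \<open>The integrating factor is \<open>exp (a / b * t powr b)\<close>, as \<open>a / b * t powr b\<close> is an
    antiderivative of \<open>a * t powr (- r / 2)\<close>.\<close>
  define K where "K = F T * exp (a / b * T powr b)"
  have F_le: "F t \<le> K * exp (- (a / b) * t powr b)" if "t \<ge> T" for t
  proof -
    have "F t * exp (a / b * t powr b) \<le> F T * exp (a / b * T powr b)"
    proof (rule DERIV_nonpos_imp_nonincreasing[OF that])
      fix u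
      assume u: "T \<le> u" "u \<le> t"
      then obtain D where D: "(F has_real_derivative D) (at u)" "D + a * u powr (- r / 2) * F u \<le> 0"
        using T[of u] by blast
      have "((\<lambda>u. exp (a / b * u powr b)) has_real_derivative
          exp (a / b * u powr b) * (a * u powr (b - 1))) (at u)"
        using T[OF u(1)] b by (auto intro!: derivative_eq_intros)
      moreover have "b - 1 = - r / 2"
        by (simp add: b_def)
      ultimately have weight: "((\<lambda>u. exp (a / b * u powr b)) has_real_derivative
          exp (a / b * u powr b) * (a * u powr (- r / 2))) (at u)"
        by simp
      have "((\<lambda>u. F u * exp (a / b * u powr b)) has_real_derivative
          (D + a * u powr (- r / 2) * F u) * exp (a / b * u powr b)) (at u)"
        by (rule DERIV_cong[OF DERIV_mult[OF D(1) weight]]) (simp add: algebra_simps)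
      moreover have "(D + a * u powr (- r / 2) * F u) * exp (a / b * u powr b) \<le> 0"
        using D(2) by (intro mult_nonpos_nonneg) auto
      ultimately show "\<exists>D. ((\<lambda>u. F u * exp (a / b * u powr b)) has_real_derivative D) (at u) \<and> D \<le> 0"
        by blast
    qed
    then have "F t * exp (a / b * t powr b) * exp (- (a / b) * t powr b)
        \<le> K * exp (- (a / b) * t powr b)"
      unfolding K_def by (intro mult_right_mono) auto
    then show ?thesis
      by (simp add: mult.assoc flip: exp_add)
  qed
  have "((\<lambda>t. t powr r * exp (- c * t powr b)) \<longlongrightarrow> 0) at_top" if "c > 0" for c
    using b r(1) that by real_asymp
  from tendsto_mult_right_zero[OF this, of "a / b" K] a b
  have "eventually (\<lambda>t. K * (t powr r * exp (- (a / b) * t powr b)) < \<theta> / 2) at_top"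
    using \<theta> by (intro order_tendstoD(2)) auto
  with eventually_ge_at_top[of T] eventually_gt_at_top[of 0]
  show ?thesis
  proof eventually_elim
    case (elim t)
    have "t powr r * t powr - r = 1"
      using elim by (simp flip: powr_add)
    then have "K * exp (- (a / b) * t powr b)
        = K * exp (- (a / b) * t powr b) * (t powr r * t powr - r)"
      by (simp only: mult_1_right)
    also have "\<dots> = K * (t powr r * exp (- (a / b) * t powr b)) * t powr - r"
      by (simp only: mult.assoc mult.left_commute)
    also have "\<dots> \<le> \<theta> / 2 * t powr - r"
      using elim by (intro mult_right_mono) auto
    finally have "F t \<le> \<theta> / 2 * t powr - r"
      using F_le[OF elim(1)] by linarith
    then show ?case
      by (simp add: F_def)
  qed
qed

section \<open>Strong convergence of the trajectory\<close>

text \<open>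
  The energy bound is used twice: with \<open>\<parallel>x t\<parallel>\<^sup>2 \<ge> 0\<close> it controls the values of \<open>f\<close>, and with
  \<open>f (x t) \<ge> f p\<close> it controls the norms.
\<close>

theorem trajectory_tendsto_min_norm:
  fixes f :: "'a::{real_inner, complete_space} \<Rightarrow> real"
  assumes convex: "convex_on UNIV f"
    and gradient: "\<And>z. GDERIV f z :> grad_f z"
    and p: "is_min_norm_element (argmin_set f) p"
    and delta: "\<delta> > 0" and r: "0 < r" "r < 2"
    and trajectory: "is_global_trajectory grad_f \<delta> r t0 x"
  shows "(x \<longlongrightarrow> p) at_top"
proof -
  obtain v w where
    x: "\<And>t. t \<ge> t0 \<Longrightarrow> (x has_vector_derivative v t) (at t within {t0..})" and
    v: "\<And>t. t \<ge> t0 \<Longrightarrow> (v has_vector_derivative w t) (at t within {t0..})" and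
    ode: "\<And>t. t \<ge> t0 \<Longrightarrow>
      w t + (\<delta> / t powr (r / 2)) *\<^sub>R v t + grad_f (x t) + (1 / t powr r) *\<^sub>R x t = 0"
    using trajectory unfolding is_global_trajectory_def by blast
  \<comment> \<open>Of order \<open>\<delta>\<close> for small and \<open>1 / \<delta>\<close> for large \<open>\<delta>\<close>; this meets the three bounds
    on \<open>a\<close> in \<open>dissipation_form_nonpos\<close> at once.\<close>
  define a where "a = \<delta> / (4 * (1 + \<delta>\<^sup>2))"
  have pos: "1 + \<delta>\<^sup>2 > 0"
    by (simp add: add_pos_nonneg)
  have a: "0 < a" "a \<le> \<delta> / 4" "a * \<delta> \<le> 1 / 4" "a \<le> 1 / 4"
    using delta pos zero_le_power2[of "\<delta> - 1 / 2"]
    by (simp_all add: a_def field_simps power2_eq_square)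
  define E where "E = energy f a r p x v"
  have "((\<lambda>t::real. r / 2 * t powr (r / 2 - 1)) \<longlongrightarrow> 0) at_top"
    using r by (intro tendsto_mult_right_zero tendsto_neg_powr filterlim_ident) auto
  then have "eventually (\<lambda>t. r / 2 * t powr (r / 2 - 1) < 2 * a) at_top"
    using a by (intro order_tendstoD(2)) auto
  with eventually_gt_at_top[of 0] eventually_gt_at_top[of t0]
  have "eventually (\<lambda>t. \<exists>D. (E has_real_derivative D) (at t) \<and>
      D + a * t powr (- r / 2) * E t \<le> r / 2 * (norm p)\<^sup>2 * t powr (- r - 1)) at_top"
  proof eventually_elim
    case (elim t)
    have interior: "at t within {t0..} = at t"
      using elim by (intro at_within_open_subset[of t "{t0<..}"]) auto
    have "w t + (\<delta> * t powr (- r / 2)) *\<^sub>R v t + grad_f (x t) + (t powr - r) *\<^sub>R x t = 0"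
      using ode[of t] elim by (simp add: powr_minus_divide)
    then show ?case
      unfolding E_def using elim x[of t] v[of t] r
      by (intro energy_differential_inequality[OF convex gradient a]) (auto simp: interior)
  qed
  note energy_small = energy_little_o[OF a(1) r _ this]
  have gap: "eventually (\<lambda>t. f (x t) - f p + t powr - r / 2 * ((norm (x t))\<^sup>2 - (norm p)\<^sup>2)
      \<le> \<theta> * t powr - r) at_top" if "\<theta> > 0" for \<theta>
    using energy_small[OF that]
  proof eventually_elim
    case (elim t)
    then show ?case
      using zero_le_power2[of "norm ((a * t powr (- r / 2)) *\<^sub>R (x t - p) + v t)"]
      unfolding E_def energy_def by linarith
  qed
  have min: "f p \<le> f z" for z
    using p by (simp add: is_min_norm_element_def argmin_set_def is_arg_min_linorder)
  show ?thesis
  proof (rule minimizing_net_tendsto_min_norm[OF convex _ p])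
    have "isCont f z" for z
      using gradient[of z] has_derivative_continuous unfolding gderiv_def by blast
    then show "continuous_on UNIV f"
      by (simp add: continuous_at_imp_continuous_on)
    show "((\<lambda>t. f (x t)) \<longlongrightarrow> f p) at_top"
    proof (rule tendsto_sandwich)
      show "eventually (\<lambda>t. f p \<le> f (x t)) at_top"
        by (simp add: min)
      show "eventually (\<lambda>t. f (x t) \<le> f p + (1 + (norm p)\<^sup>2 / 2) * t powr - r) at_top"
        using gap[OF zero_less_one]
      proof eventually_elim
        case (elim t)
        have "f (x t) \<le> f p + t powr - r + t powr - r / 2 * ((norm p)\<^sup>2 - (norm (x t))\<^sup>2)"
          using elim by (simp add: algebra_simps)
        also have "\<dots> \<le> f p + t powr - r + t powr - r / 2 * (norm p)\<^sup>2"
          by (intro add_left_mono mult_left_mono) auto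
        finally show ?case
          by (simp add: algebra_simps)
      qed
      have "((\<lambda>t::real. t powr - r) \<longlongrightarrow> 0) at_top"
        using r by (intro tendsto_neg_powr filterlim_ident) auto
      from tendsto_add[OF tendsto_const tendsto_mult_right_zero[OF this]]
      show "((\<lambda>t. f p + (1 + (norm p)\<^sup>2 / 2) * t powr - r) \<longlongrightarrow> f p) at_top"
        by simp
    qed simp
    fix e :: real
    assume "e > 0"
    then have "e / 2 > 0"
      by simp
    from gap[OF this] eventually_gt_at_top[of 0]
    show "eventually (\<lambda>t. (norm (x t))\<^sup>2 \<le> (norm p)\<^sup>2 + e) at_top"
    proof eventually_elim
      case (elim t)
      have "t powr - r * ((norm (x t))\<^sup>2 - (norm p)\<^sup>2) \<le> t powr - r * e"
        using elim(1) min[of "x t"] by (simp add: mult.commute[of e])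
      then show ?case
        using elim(2) by simp
    qed
  qed
qed

theorem theorem11:
  fixes f :: "'a::{real_inner, complete_space} \<Rightarrow> real"
    and grad_f :: "'a \<Rightarrow> 'a"
    and xstar :: 'a
    and x :: "real \<Rightarrow> 'a"
    and t0 \<delta> r :: real
  assumes convex: "convex_on UNIV f"
    and gradient: "\<And>z. GDERIV f z :> grad_f z"
    and lipschitz: "lipschitz_on_bounded_sets grad_f"
    and nonempty: "argmin_set f \<noteq> {}"
    and xstar: "is_min_norm_element (argmin_set f) xstar"
    and t0: "t0 > 0"
    and delta: "\<delta> > 0"
    and r: "2 / 3 < r" "r < 2"
    and trajectory: "is_global_trajectory grad_f \<delta> r t0 x"
  shows "Liminf at_top (\<lambda>t. ereal (norm (x t - xstar))) = 0 \<and>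
    ((\<exists>T\<ge>t0. (\<forall>t\<ge>T. x t \<in> ball 0 (norm xstar)) \<or> (\<forall>t\<ge>T. x t \<in> - ball 0 (norm xstar)))
      \<longrightarrow> (x \<longlongrightarrow> xstar) at_top)"
proof -
  have lim: "(x \<longlongrightarrow> xstar) at_top"
    using r by (intro trajectory_tendsto_min_norm[OF convex gradient xstar delta _ _ trajectory]) auto
  then have "((\<lambda>t. ereal (norm (x t - xstar))) \<longlongrightarrow> ereal 0) at_top"
    by (intro tendsto_intros) (simp add: LIM_zero_iff tendsto_norm_zero)
  then have "Liminf at_top (\<lambda>t. ereal (norm (x t - xstar))) = ereal 0"
    by (intro lim_imp_Liminf) auto
  with lim show ?thesis
    by (simp add: zero_ereal_def)
qed

end
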